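(* Let $b>0$, let $q\in C[-b,b]$ be complex valued, let $h\in\mathbb{C}$, and let $\mathbf{K}$ be the transmutation kernel associated with $q$ and $h$ (defined in the context). Put $Q(x):=\int_0^x q(s)\,ds$. Then for all $x\in[-b,b]$ $$\mathbf{K}_1(x,x)=\frac14\left(q(x)+hQ(x)+\frac{Q^2(x)}{2}\right)\qquad\text{and}\qquad \mathbf{K}_2(x,x)=\frac14\left(q(x)-hQ(x)-\frac{Q^2(x)}{2}\right).$$
   Context: The kernel is $\mathbf{K}(x,t)=\mathbf{H}\big(\frac{x+t}{2},\frac{x-t}{2}\big)$ for $(x,t)\in\overline{\mathbf{S}}=[-b,b]\times[-b,b]$, where $\mathbf{H}$ is the unique solution of the Goursat problem $\frac{\partial^2\mathbf{H}(u,v)}{\partial u\,\partial v}=q(u+v)\mathbf{H}(u,v)$, $\mathbf{H}(u,0)=\frac h2+\frac12\int_0^u q(s)\,ds$, $\mathbf{H}(0,v)=\frac h2$; equivalently, $\mathbf{H}(u,v)=\frac h2+\frac12\int_0^u q(s)\,ds+\int_0^u\int_0^v q(\alpha+\beta)\mathbf{H}(\alpha,\beta)\,d\beta\,d\alpha$. The kernel is continuously differentiable on $\overline{\mathbf{S}}$. $\mathbf{K}_1(x,t)$ and $\mathbf{K}_2(x,t)$ denote the partial derivatives of $\mathbf{K}$ with respect to its first and second variable respectively; $\mathbf{K}_i(x,x)$ is the value of this partial derivative at the point $(x,x)$. (One-sided derivatives at the boundary of the square.) *)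

theory Defs
  imports "HOL-Analysis.Analysis"
begin

text \<open>The interval integral is oriented, so this is \<open>\<integral>\<^sub>0\<^sup>x q\<close> for negative \<open>x\<close> too.\<close>

definition potential_primitive :: "(real \<Rightarrow> complex) \<Rightarrow> real \<Rightarrow> complex" where
  "potential_primitive q x = (LBINT s=0..ereal x. q s)"

text \<open>
  The Goursat problem is posed on the diamond \<open>\<bar>u\<bar> + \<bar>v\<bar> \<le> b\<close>, the image of the square
  \<open>[-b,b] \<times> [-b,b]\<close> under \<open>(x,t) \<mapsto> ((x+t)/2, (x-t)/2)\<close>. A solution is continuous on the closed
  diamond and satisfies the equation in its interior; at a corner of the closed diamond a
  line parallel to one of the axes meets it in a single point only, so a one-sided derivative
  would carry no information there. \<open>Hv\<close> is \<open>\<partial>H/\<partial>v\<close>.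
\<close>

definition goursat_solution ::
  "real \<Rightarrow> (real \<Rightarrow> complex) \<Rightarrow> complex \<Rightarrow> (real \<Rightarrow> real \<Rightarrow> complex) \<Rightarrow> bool" where
  "goursat_solution b q h H \<longleftrightarrow>
     continuous_on {(u, v). \<bar>u\<bar> + \<bar>v\<bar> \<le> b} (\<lambda>(u, v). H u v) \<and>
     (\<exists>Hv. \<forall>u v. \<bar>u\<bar> + \<bar>v\<bar> < b \<longrightarrow>
        ((\<lambda>v'. H u v') has_vector_derivative Hv u v) (at v) \<and>
        ((\<lambda>u'. Hv u' v) has_vector_derivative q (u + v) * H u v) (at u)) \<and>
     (\<forall>u. \<bar>u\<bar> \<le> b \<longrightarrow> H u 0 = h / 2 + potential_primitive q u / 2) \<and>
     (\<forall>v. \<bar>v\<bar> \<le> b \<longrightarrow> H 0 v = h / 2)"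

definition transmutation_kernel ::
  "real \<Rightarrow> (real \<Rightarrow> complex) \<Rightarrow> complex \<Rightarrow> (real \<Rightarrow> real \<Rightarrow> complex) \<Rightarrow> bool" where
  "transmutation_kernel b q h K \<longleftrightarrow>
     (\<exists>H. goursat_solution b q h H \<and>
        (\<forall>x\<in>{-b..b}. \<forall>t\<in>{-b..b}. K x t = H ((x + t) / 2) ((x - t) / 2)))"

end

theory Submission
  imports Defs
begin

text \<open>
  Write \<open>Q\<close> for \<open>potential_primitive q\<close> and \<open>G u = \<integral>\<^sub>0\<^sup>u q(\<alpha>) H(\<alpha>,0) d\<alpha>\<close>. On the axis
  \<open>H(\<alpha>,0) = h/2 + Q(\<alpha>)/2\<close> and \<open>q = Q'\<close>, so \<open>G = h Q/2 + Q\<^sup>2/4\<close>. Since \<open>H(0,v)\<close> is constant,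
  \<open>\<partial>H/\<partial>v\<close> vanishes on \<open>u = 0\<close>, and integrating the Goursat equation in \<open>u\<close> shows that
  \<open>\<partial>H/\<partial>v\<close> equals \<open>G u\<close> at \<open>(u,0)\<close>. Hence \<open>H(u,v) = H(u,0) + v G(u) + o(v)\<close>.

  The diagonal of the square corresponds to the axis \<open>v = 0\<close> of the diamond, and moving one
  variable of \<open>K\<close> away from \<open>(x,x)\<close> moves \<open>(u,v)\<close> from \<open>(x,0)\<close> in the direction \<open>(1/2, 1/2)\<close> or
  \<open>(1/2, -1/2)\<close>. The expansion then gives the derivatives \<open>q(x)/4 + G(x)/2\<close> and
  \<open>q(x)/4 - G(x)/2\<close>, which are the claimed values.

  Two points need care. Both \<open>u\<close> and \<open>v\<close> vary along these lines, so the remainder must be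
  \<open>o(v)\<close> uniformly in \<open>u\<close>; this comes from the uniform continuity of \<open>q(u+v) H(u,v)\<close> on the
  compact diamond. For \<open>x = b\<close> or \<open>x = -b\<close> the lines run along the edges of the diamond, where
  the differential equation says nothing; the expansion, being a non-strict inequality between
  continuous functions, extends there from the interior (\<open>goursat_expansion\<close>).
\<close>

text \<open>
  The mean value inequality along a segment whose endpoints may come in either order: the
  increments below run from \<open>0\<close> to a \<open>u\<close> or \<open>v\<close> of unknown sign.
\<close>

lemma norm_increment_le_segment:
  fixes f :: "real \<Rightarrow> 'a::real_normed_vector"
  assumes deriv: "\<And>t. t \<in> closed_segment a c \<Longrightarrow>
      (f has_vector_derivative f' t) (at t within closed_segment a c)"
    and bound: "\<And>t. t \<in> closed_segment a c \<Longrightarrow> norm (f' t) \<le> B"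
  shows "norm (f c - f a) \<le> B * \<bar>c - a\<bar>"
proof -
  have "norm (f c - f a) \<le> B * norm (c - a)"
  proof (rule differentiable_bound[where S = "closed_segment a c"
        and f' = "\<lambda>t h. h *\<^sub>R f' t"])
    fix t assume t: "t \<in> closed_segment a c"
    show "(f has_derivative (\<lambda>h. h *\<^sub>R f' t)) (at t within closed_segment a c)"
      using deriv[OF t] by (simp add: has_vector_derivative_def)
    show "onorm (\<lambda>h. h *\<^sub>R f' t) \<le> B"
      using onorm_scaleR_left[OF bounded_linear_ident, of "f' t"] bound[OF t]
      by (simp add: onorm_id)
  qed auto
  then show ?thesis by simp
qed

lemma potential_primitive_has_vector_derivative:
  assumes "continuous_on {-b..b} q" and "x \<in> {-b..b}"
  shows "(potential_primitive q has_vector_derivative q x) (at x within {-b..b})"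
proof -
  have "((\<lambda>u. LBINT s=ereal 0..ereal u. q s) has_vector_derivative q x) (at x within {-b..b})"
    using assms by (intro interval_integral_FTC2) auto
  then show ?thesis
    by (simp add: potential_primitive_def[abs_def] zero_ereal_def)
qed

lemma potential_primitive_0 [simp]: "potential_primitive q 0 = 0"
  by (simp add: potential_primitive_def zero_ereal_def)

text \<open>
  The function \<open>G\<close> above, that is \<open>\<partial>H/\<partial>v\<close> along the axis \<open>v = 0\<close>.
\<close>

definition axis_slope :: "(real \<Rightarrow> complex) \<Rightarrow> complex \<Rightarrow> real \<Rightarrow> complex" where
  "axis_slope q h u = h * potential_primitive q u / 2 + (potential_primitive q u)\<^sup>2 / 4"

text \<open>
  The derivative is \<open>q(u) H(u,0)\<close>, which is the derivative in \<open>u\<close> of \<open>\<partial>H/\<partial>v\<close> at \<open>(u,0)\<close>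
  according to the Goursat equation. This is what identifies the two functions.
\<close>

lemma axis_slope_has_vector_derivative:
  assumes "continuous_on {-b..b} q" and "u \<in> {-b..b}"
  shows "(axis_slope q h has_vector_derivative
      q u * (h / 2 + potential_primitive q u / 2)) (at u within {-b..b})"
  unfolding axis_slope_def[abs_def] power2_eq_square divide_inverse
  by (rule has_vector_derivative_eq_rhs,
      (rule derivative_intros potential_primitive_has_vector_derivative assms)+)
     (simp add: field_simps)

lemma continuous_on_axis_slope:
  "continuous_on {-b..b} q \<Longrightarrow> continuous_on {-b..b} (axis_slope q h)"
  by (meson axis_slope_has_vector_derivative continuous_on_vector_derivative)

lemma compact_diamond: "compact {(u, v). \<bar>u\<bar> + \<bar>v\<bar> \<le> (b::real)}"
proof -
  have "closed {p. \<bar>fst p\<bar> + \<bar>snd p\<bar> \<le> b}"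
    by (intro closed_Collect_le continuous_intros)
  moreover have "{p. \<bar>fst p\<bar> + \<bar>snd p\<bar> \<le> b} \<subseteq> {-b..b} \<times> {-b..b}"
    by (auto simp: abs_le_iff)
  then have "bounded {p. \<bar>fst p\<bar> + \<bar>snd p\<bar> \<le> b}"
    by (rule bounded_subset[rotated]) (intro bounded_Times bounded_closed_interval)
  ultimately show ?thesis
    by (simp add: compact_eq_bounded_closed case_prod_unfold)
qed

lemma continuous_on_goursat_source:
  fixes q :: "real \<Rightarrow> complex"
  assumes "continuous_on {-b..b} q"
    and "continuous_on {(u, v). \<bar>u\<bar> + \<bar>v\<bar> \<le> b} (\<lambda>(u, v). H u v)"
  shows "continuous_on {(u, v). \<bar>u\<bar> + \<bar>v\<bar> \<le> b} (\<lambda>p. q (fst p + snd p) * H (fst p) (snd p))"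
proof (intro continuous_on_mult)
  show "continuous_on {(u, v). \<bar>u\<bar> + \<bar>v\<bar> \<le> b} (\<lambda>p. q (fst p + snd p))"
    by (rule continuous_on_compose2[OF assms(1)]) (auto intro!: continuous_intros)
  show "continuous_on {(u, v). \<bar>u\<bar> + \<bar>v\<bar> \<le> b} (\<lambda>p. H (fst p) (snd p))"
    using assms(2) by (simp add: case_prod_unfold)
qed

text \<open>
  The mean value inequality is applied twice. In \<open>u\<close>, to \<open>\<partial>H/\<partial>v (u,v) - G u\<close>: its derivative
  is the difference of the values of \<open>q(u+v) H(u,v)\<close> at \<open>(u,v)\<close> and \<open>(u,0)\<close>, which is uniformly
  small for small \<open>v\<close>, and it vanishes at \<open>u = 0\<close>. Then in \<open>v\<close>, to \<open>H(u,v) - v G(u)\<close>. All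
  segments used stay in the open diamond, because it contains with \<open>(u,v)\<close> the rectangle
  spanned by \<open>(u,v)\<close> and the origin.
\<close>

lemma goursat_expansion_interior:
  assumes b: "b > 0" and q: "continuous_on {-b..b} q"
    and G: "goursat_solution b q h H" and \<epsilon>: "\<epsilon> > 0"
  obtains \<delta> where "\<delta> > 0"
    "\<And>u v. \<bar>u\<bar> + \<bar>v\<bar> < b \<Longrightarrow> \<bar>v\<bar> < \<delta> \<Longrightarrow>
       norm (H u v - H u 0 - v *\<^sub>R axis_slope q h u) \<le> \<epsilon> * \<bar>v\<bar>"
proof -
  define F where "F = (\<lambda>p. q (fst p + snd p) * H (fst p) (snd p))"
  from G obtain Hv where
    Hv: "\<And>u v. \<bar>u\<bar> + \<bar>v\<bar> < b \<Longrightarrow> ((\<lambda>v'. H u v') has_vector_derivative Hv u v) (at v)"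
    and Hvu: "\<And>u v. \<bar>u\<bar> + \<bar>v\<bar> < b \<Longrightarrow>
        ((\<lambda>u'. Hv u' v) has_vector_derivative q (u + v) * H u v) (at u)"
    and H0: "\<And>u. \<bar>u\<bar> \<le> b \<Longrightarrow> H u 0 = h / 2 + potential_primitive q u / 2"
    and HV: "\<And>v. \<bar>v\<bar> \<le> b \<Longrightarrow> H 0 v = h / 2"
    and Hc: "continuous_on {(u, v). \<bar>u\<bar> + \<bar>v\<bar> \<le> b} (\<lambda>(u, v). H u v)"
    unfolding goursat_solution_def by blast
  have "uniformly_continuous_on {(u, v). \<bar>u\<bar> + \<bar>v\<bar> \<le> b} F"
    unfolding F_def
    by (intro compact_uniformly_continuous continuous_on_goursat_source q Hc compact_diamond)
  \<comment> \<open>The mean value inequality in \<open>u\<close> loses a factor \<open>\<bar>u\<bar> \<le> b\<close>, hence the bound \<open>\<epsilon> / b\<close>.\<close>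
  then obtain \<delta> where \<delta>: "\<delta> > 0"
    and F: "\<And>p p'. p \<in> {(u, v). \<bar>u\<bar> + \<bar>v\<bar> \<le> b} \<Longrightarrow> p' \<in> {(u, v). \<bar>u\<bar> + \<bar>v\<bar> \<le> b} \<Longrightarrow>
        dist p' p < \<delta> \<Longrightarrow> dist (F p') (F p) < \<epsilon> / b"
    using b \<epsilon> unfolding uniformly_continuous_on_def by (metis divide_pos_pos)
  have Hv0: "Hv 0 v = 0" if "\<bar>v\<bar> < b" for v
  proof -
    have "((\<lambda>v'. H 0 v') has_vector_derivative 0) (at v)"
      by (rule has_vector_derivative_transform_within_open
            [where f = "\<lambda>_. h / 2" and S = "{-b<..<b}"])
         (use that HV in \<open>auto simp: abs_le_iff\<close>)
    moreover have "((\<lambda>v'. H 0 v') has_vector_derivative Hv 0 v) (at v)"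
      using Hv[of 0 v] that by simp
    ultimately show ?thesis by (metis vector_derivative_at)
  qed
  have slope: "norm (Hv u v - axis_slope q h u) \<le> \<epsilon>" if uv: "\<bar>u\<bar> + \<bar>v\<bar> < b" and v: "\<bar>v\<bar> < \<delta>" for u v
  proof -
    have seg: "\<bar>t\<bar> \<le> \<bar>u\<bar>" if "t \<in> closed_segment 0 u" for t
      using that by (auto simp: closed_segment_eq_real_ivl split: if_splits)
    have "norm ((Hv u v - axis_slope q h u) - (Hv 0 v - axis_slope q h 0)) \<le> \<epsilon> / b * \<bar>u - 0\<bar>"
    proof (rule norm_increment_le_segment[where f = "\<lambda>t. Hv t v - axis_slope q h t"
          and f' = "\<lambda>t. q (t + v) * H t v - q t * H t 0"])
      fix t assume t: "t \<in> closed_segment 0 u"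
      have tv: "\<bar>t\<bar> + \<bar>v\<bar> < b" using seg[OF t] uv by simp
      have "t \<in> {-b..b}" using tv by auto
      then have "((axis_slope q h) has_vector_derivative q t * H t 0) (at t within {-b..b})"
        using axis_slope_has_vector_derivative[OF q, of t h] H0[of t] tv by simp
      then have "((axis_slope q h) has_vector_derivative q t * H t 0) (at t within closed_segment 0 u)"
        by (rule has_vector_derivative_within_subset) (use seg uv in force)
      then show "((\<lambda>t. Hv t v - axis_slope q h t) has_vector_derivative
            q (t + v) * H t v - q t * H t 0) (at t within closed_segment 0 u)"
        by (intro has_vector_derivative_diff has_vector_derivative_at_within[OF Hvu[OF tv]])
      have "dist (F (t, v)) (F (t, 0)) < \<epsilon> / b"
        using tv v by (intro F) (auto simp: dist_Pair_Pair)
      then show "norm (q (t + v) * H t v - q t * H t 0) \<le> \<epsilon> / b"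
        by (simp add: F_def dist_norm)
    qed
    also have "\<dots> \<le> \<epsilon> / b * b" using uv b \<epsilon> by (intro mult_left_mono) auto
    finally show ?thesis using Hv0[of v] uv b by (simp add: axis_slope_def)
  qed
  show thesis
  proof (rule that[OF \<delta>])
    fix u v assume uv: "\<bar>u\<bar> + \<bar>v\<bar> < b" and v: "\<bar>v\<bar> < \<delta>"
    have seg: "\<bar>t\<bar> \<le> \<bar>v\<bar>" if "t \<in> closed_segment 0 v" for t
      using that by (auto simp: closed_segment_eq_real_ivl split: if_splits)
    have "norm ((H u v - v *\<^sub>R axis_slope q h u) - (H u 0 - 0 *\<^sub>R axis_slope q h u)) \<le> \<epsilon> * \<bar>v - 0\<bar>"
    proof (rule norm_increment_le_segment[where f = "\<lambda>t. H u t - t *\<^sub>R axis_slope q h u"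
          and f' = "\<lambda>t. Hv u t - axis_slope q h u"])
      fix t assume t: "t \<in> closed_segment 0 v"
      have ut: "\<bar>u\<bar> + \<bar>t\<bar> < b" using seg[OF t] uv by simp
      have "((\<lambda>t. t *\<^sub>R axis_slope q h u) has_vector_derivative axis_slope q h u) (at t)"
        by (auto intro!: derivative_eq_intros)
      then show "((\<lambda>t. H u t - t *\<^sub>R axis_slope q h u) has_vector_derivative
            Hv u t - axis_slope q h u) (at t within closed_segment 0 v)"
        by (rule has_vector_derivative_at_within[OF has_vector_derivative_diff[OF Hv[OF ut]]])
      show "norm (Hv u t - axis_slope q h u) \<le> \<epsilon>"
        using slope[OF ut] seg[OF t] v by simp
    qed
    then show "norm (H u v - H u 0 - v *\<^sub>R axis_slope q h u) \<le> \<epsilon> * \<bar>v\<bar>"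
      by (simp add: algebra_simps)
  qed
qed

text \<open>
  The open diamond is star-shaped about the origin, so a point \<open>(u,v)\<close> of its boundary is the
  limit of the interior points \<open>(r u, r v)\<close> as \<open>r\<close> tends to \<open>1\<close> from below. For these,
  \<open>\<bar>r v\<bar> \<le> \<bar>v\<bar>\<close>, so the same \<open>\<delta>\<close> serves.
\<close>

lemma goursat_expansion:
  assumes b: "b > 0" and q: "continuous_on {-b..b} q"
    and G: "goursat_solution b q h H" and \<epsilon>: "\<epsilon> > 0"
  obtains \<delta> where "\<delta> > 0"
    "\<And>u v. \<bar>u\<bar> + \<bar>v\<bar> \<le> b \<Longrightarrow> \<bar>v\<bar> < \<delta> \<Longrightarrow>
       norm (H u v - H u 0 - v *\<^sub>R axis_slope q h u) \<le> \<epsilon> * \<bar>v\<bar>"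
proof -
  from G have Hc: "continuous_on {(u, v). \<bar>u\<bar> + \<bar>v\<bar> \<le> b} (\<lambda>p. H (fst p) (snd p))"
    by (simp add: goursat_solution_def case_prod_unfold)
  obtain \<delta> where \<delta>: "\<delta> > 0" and interior: "\<And>u v. \<bar>u\<bar> + \<bar>v\<bar> < b \<Longrightarrow> \<bar>v\<bar> < \<delta> \<Longrightarrow>
       norm (H u v - H u 0 - v *\<^sub>R axis_slope q h u) \<le> \<epsilon> * \<bar>v\<bar>"
    using goursat_expansion_interior[OF assms] by blast
  show thesis
  proof (rule that[OF \<delta>])
    fix u v assume uv: "\<bar>u\<bar> + \<bar>v\<bar> \<le> b" and v: "\<bar>v\<bar> < \<delta>"
    define g where
      "g r = norm (H (r * u) (r * v) - H (r * u) 0 - (r * v) *\<^sub>R axis_slope q h (r * u))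
        - \<epsilon> * \<bar>r * v\<bar>" for r
    have scaled: "\<bar>r * u\<bar> + \<bar>r * v\<bar> \<le> r * b" if "0 \<le> r" for r
      using mult_left_mono[OF uv that] that by (simp add: abs_mult distrib_left)
    have inside: "\<bar>r * u\<bar> + \<bar>r * v\<bar> \<le> b" if "r \<in> {0..1}" for r
      by (rule order_trans[OF scaled mult_left_le_one_le]) (use that b in auto)
    have "continuous_on {0..1} (\<lambda>r. H (fst (r * u, r * v)) (snd (r * u, r * v)))"
      by (rule continuous_on_compose2[OF Hc]) (use inside in \<open>auto intro!: continuous_intros\<close>)
    moreover have "continuous_on {0..1} (\<lambda>r. H (fst (r * u, 0::real)) (snd (r * u, 0::real)))"
      by (rule continuous_on_compose2[OF Hc]) (use inside in \<open>force intro!: continuous_intros\<close>)+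
    moreover have "continuous_on {0..1} (\<lambda>r. axis_slope q h (r * u))"
      by (rule continuous_on_compose2[OF continuous_on_axis_slope[OF q]])
         (use inside in \<open>force intro!: continuous_intros\<close>)+
    ultimately have "continuous_on {0..1} g"
      unfolding g_def by (intro continuous_intros) auto
    moreover have "g r \<le> 0" if "r \<in> {0..<1}" for r
    proof -
      have "\<bar>r * u\<bar> + \<bar>r * v\<bar> < b"
        by (rule order.strict_trans1[OF scaled]) (use that b in auto)
      moreover have "\<bar>r * v\<bar> < \<delta>"
        using mult_right_mono[of r 1 "\<bar>v\<bar>"] that v by (auto simp: abs_mult)
      ultimately show ?thesis using interior by (simp add: g_def)
    qed
    ultimately have "g 1 \<le> 0"
      using continuous_le_on_closure[of "{0..<1::real}" g 1 0] by simp
    then show "norm (H u v - H u 0 - v *\<^sub>R axis_slope q h u) \<le> \<epsilon> * \<bar>v\<bar>"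
      by (simp add: g_def)
  qed
qed

text \<open>
  The sign \<open>\<sigma>\<close> treats both partial derivatives of \<open>K\<close> at once. The main part \<open>M\<close> of the
  expansion is defined through \<open>Q\<close> and \<open>G\<close>, so it is differentiable up to the ends of the
  interval; the remainder \<open>R\<close> is \<open>o(s - x)\<close>, hence has derivative \<open>0\<close> at \<open>x\<close>. At \<open>s = x\<close> the
  factor in front of \<open>G\<close> is zero, and therefore \<open>G\<close> contributes its value only.
\<close>

lemma goursat_oblique_derivative:
  assumes b: "b > 0" and q: "continuous_on {-b..b} q"
    and G: "goursat_solution b q h H" and x: "x \<in> {-b..b}" and \<sigma>: "\<bar>\<sigma>\<bar> = 1"
  shows "((\<lambda>s. H ((x + s) / 2) (\<sigma> * (s - x) / 2)) has_vector_derivative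
      (1 / 4) * q x + (\<sigma> / 2) *\<^sub>R axis_slope q h x) (at x within {-b..b})"
proof -
  define M where "M s = h / 2 + potential_primitive q ((x + s) / 2) / 2
      + (\<sigma> * (s - x) / 2) *\<^sub>R axis_slope q h ((x + s) / 2)" for s
  define R where "R s = H ((x + s) / 2) (\<sigma> * (s - x) / 2) - M s" for s
  have H0: "H u 0 = h / 2 + potential_primitive q u / 2" if "\<bar>u\<bar> \<le> b" for u
    using G that by (auto simp: goursat_solution_def)
  have mid: "(\<lambda>s. (x + s) / 2) ` {-b..b} \<subseteq> {-b..b}" using x by auto
  have chain: "((\<lambda>s. f ((x + s) / 2)) has_vector_derivative (1 / 2) *\<^sub>R f') (at x within {-b..b})"
    if f: "(f has_vector_derivative f') (at x within {-b..b})" for f :: "real \<Rightarrow> complex" and f'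
  proof -
    have "((\<lambda>s. (x + s) / 2) has_vector_derivative 1 / 2) (at x within {-b..b})"
      by (auto intro!: derivative_eq_intros simp: has_real_derivative_iff_has_vector_derivative[symmetric])
    moreover have "(f has_vector_derivative f') (at ((x + x) / 2) within (\<lambda>s. (x + s) / 2) ` {-b..b})"
      using has_vector_derivative_within_subset[OF f mid] by simp
    ultimately show ?thesis
      using vector_diff_chain_within unfolding o_def by blast
  qed
  have "((\<lambda>s. \<sigma> * (s - x) / 2) has_real_derivative \<sigma> / 2) (at x within {-b..b})"
    by (auto intro!: derivative_eq_intros)
  then have M: "(M has_vector_derivative (1 / 4) * q x + (\<sigma> / 2) *\<^sub>R axis_slope q h x)
      (at x within {-b..b})"
    unfolding M_def[abs_def]
    by (auto intro!: derivative_eq_intros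
        chain[OF potential_primitive_has_vector_derivative[OF q x]]
        chain[OF axis_slope_has_vector_derivative[OF q x]] simp: scaleR_conv_of_real)
  have "(R has_vector_derivative 0) (at x within {-b..b})"
    unfolding has_vector_derivative_def has_derivative_within_alt
  proof (intro conjI allI impI)
    fix \<epsilon> :: real assume "\<epsilon> > 0"
    then obtain \<delta> where \<delta>: "\<delta> > 0" and ex: "\<And>u v. \<bar>u\<bar> + \<bar>v\<bar> \<le> b \<Longrightarrow> \<bar>v\<bar> < \<delta> \<Longrightarrow>
       norm (H u v - H u 0 - v *\<^sub>R axis_slope q h u) \<le> \<epsilon> * \<bar>v\<bar>"
      using goursat_expansion[OF b q G] by blast
    have "norm (R y - R x - (y - x) *\<^sub>R 0) \<le> \<epsilon> * norm (y - x)"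
      if y: "y \<in> {-b..b}" and d: "norm (y - x) < \<delta>" for y
    proof -
      have av: "\<bar>\<sigma> * (y - x) / 2\<bar> = \<bar>y - x\<bar> / 2" using \<sigma> by (simp add: abs_mult)
      have dia: "\<bar>(x + y) / 2\<bar> + \<bar>\<sigma> * (y - x) / 2\<bar> \<le> b" "\<bar>(x + y) / 2\<bar> \<le> b"
        using x y unfolding av by (auto simp: abs_if field_simps)
      have "R x = 0" using H0[of x] x by (auto simp: R_def M_def)
      moreover have "norm (R y) \<le> \<epsilon> * (\<bar>y - x\<bar> / 2)"
        using ex[OF dia(1)] d unfolding av H0[OF dia(2)]
        by (simp add: R_def M_def algebra_simps)
      moreover have "\<epsilon> * (\<bar>y - x\<bar> / 2) \<le> \<epsilon> * \<bar>y - x\<bar>" using \<open>\<epsilon> > 0\<close> by simp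
      ultimately show ?thesis by simp
    qed
    then show "\<exists>d>0. \<forall>y\<in>{-b..b}. norm (y - x) < d \<longrightarrow>
        norm (R y - R x - (y - x) *\<^sub>R 0) \<le> \<epsilon> * norm (y - x)"
      using \<delta> by blast
  qed simp
  from has_vector_derivative_add[OF this M] show ?thesis
    by (simp add: R_def)
qed

theorem proposition2p7:
  fixes b :: real and q :: "real \<Rightarrow> complex" and h :: complex
    and K :: "real \<Rightarrow> real \<Rightarrow> complex"
  assumes "b > 0"
    and "continuous_on {-b..b} q"
    and "transmutation_kernel b q h K"
  shows "\<forall>x\<in>{-b..b}.
    ((\<lambda>s. K s x) has_vector_derivative
       (1 / 4) * (q x + h * potential_primitive q x + (potential_primitive q x)\<^sup>2 / 2))
       (at x within {-b..b}) \<and>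
    ((\<lambda>t. K x t) has_vector_derivative
       (1 / 4) * (q x - h * potential_primitive q x - (potential_primitive q x)\<^sup>2 / 2))
       (at x within {-b..b})"
proof (intro ballI conjI)
  fix x assume x: "x \<in> {-b..b}"
  from assms(3) obtain H where G: "goursat_solution b q h H"
    and K: "\<And>x t. x \<in> {-b..b} \<Longrightarrow> t \<in> {-b..b} \<Longrightarrow> K x t = H ((x + t) / 2) ((x - t) / 2)"
    unfolding transmutation_kernel_def by blast
  note oblique = goursat_oblique_derivative[OF assms(1,2) G x]
  have "((\<lambda>s. H ((x + s) / 2) ((s - x) / 2)) has_vector_derivative
      (1 / 4) * (q x + h * potential_primitive q x + (potential_primitive q x)\<^sup>2 / 2))
      (at x within {-b..b})"
    using oblique[of 1] by (simp add: axis_slope_def scaleR_conv_of_real field_simps)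
  then show "((\<lambda>s. K s x) has_vector_derivative
      (1 / 4) * (q x + h * potential_primitive q x + (potential_primitive q x)\<^sup>2 / 2))
      (at x within {-b..b})"
    by (rule has_vector_derivative_transform[OF x, rotated]) (use K x in \<open>simp add: add.commute\<close>)
  have "((\<lambda>t. H ((x + t) / 2) ((x - t) / 2)) has_vector_derivative
      (1 / 4) * (q x - h * potential_primitive q x - (potential_primitive q x)\<^sup>2 / 2))
      (at x within {-b..b})"
    using oblique[of "-1"] by (simp add: axis_slope_def scaleR_conv_of_real field_simps)
  then show "((\<lambda>t. K x t) has_vector_derivative
      (1 / 4) * (q x - h * potential_primitive q x - (potential_primitive q x)\<^sup>2 / 2))
      (at x within {-b..b})"
    by (rule has_vector_derivative_transform[OF x, rotated]) (use K x in simp)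
qed

end
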